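(* Consider the system $\mathsf{IL}+\mathsf{HMP}$ described below. (1) If $\vdash t : \exists\alpha\, A$ is derivable in $\mathsf{IL}+\mathsf{HMP}$ (empty context) and $t$ is in normal form, then $t=(m,u)$ for some first-order term $m$ and proof term $u$, and $\vdash u : A[m/\alpha]$ is derivable in $\mathsf{IL}+\mathsf{HMP}$. (2) If $\vdash t : A\lor B$ is derivable in $\mathsf{IL}+\mathsf{HMP}$ (empty context) and $t$ is in normal form, then either $t=\iota_0(u)$ and $\vdash u:A$ is derivable in $\mathsf{IL}+\mathsf{HMP}$, or $t=\iota_1(u)$ and $\vdash u:B$ is derivable in $\mathsf{IL}+\mathsf{HMP}$.
   Context: Fix a first-order language $\mathcal{L}$; formulas are built from atomic formulas and $\bot$ with $\land,\lor,\rightarrow,\forall,\exists$, with $\lnot A:=A\rightarrow\bot$; a propositional formula is a quantifier-free one. Proof terms: $t,u,v ::= x \mid tu \mid tm \mid \lambda x.u \mid \lambda\alpha.u \mid \langle t,u\rangle \mid \pi_0 u \mid \pi_1 u \mid \iota_0(u)\mid \iota_1(u) \mid t[x.u,y.v] \mid (m,t) \mid t[(\alpha,x).u] \mid \mathsf{H}_0^{\bot\rightarrow P} \mid \mathsf{MP}_P$, where $m$ ranges over terms of $\mathcal{L}$, $x,y$ over proof variables, $\alpha$ over first-order variables. Judgments $\Gamma\vdash t:A$ with $\Gamma=x_1:A_1,\dots,x_n:A_n$ (distinct variables) are generated by: $\Gamma,x:A\vdash x:A$; $\Gamma\vdash \mathsf{MP}_P:\lnot\lnot\exists\alpha\,P\rightarrow\exists\alpha\,P$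 for every propositional $P$ in which $\rightarrow$ does not occur; $\Gamma\vdash \mathsf{H}_0^{\bot\rightarrow P}:\bot\rightarrow P$; from $u:A$ and $t:B$ infer $\langle u,t\rangle:A\land B$; from $u:A\land B$ infer $\pi_0u:A$, $\pi_1u:B$; from $t:A\rightarrow B$ and $u:A$ infer $tu:B$; from $\Gamma,x:A\vdash u:B$ infer $\lambda x.u:A\rightarrow B$; from $u:A$ infer $\iota_0(u):A\lor B$, from $u:B$ infer $\iota_1(u):A\lor B$; from $u:A\lor B$, $\Gamma,x:A\vdash w_1:C$, $\Gamma,y:B\vdash w_2:C$ infer $u[x.w_1,y.w_2]:C$; from $u:\forall\alpha A$ infer $um:A[m/\alpha]$; from $u:A$ infer $\lambda\alpha.u:\forall\alpha A$ if $\alpha$ is not free in $\Gamma$; from $u:A[m/\alpha]$ infer $(m,u):\exists\alpha A$; from $u:\exists\alpha A$ and $\Gamma,x:A\vdash t:C$ infer $u[(\alpha,x).t]:C$ if $\alpha$ is not free in $C$ nor in $\Gamma$. Reduction rules (applicable to any subterm): $(\lambda x.u)t\mapsto u[t/x]$; $(\lambda\alpha.u)m\mapsto u[m/\alpha]$; $\pi_i\langle u_0,u_1\rangle\mapsto u_i$; $\iota_i(u)[x_0.t_0,x_1.t_1]\mapsto t_i[u/x_i]$; $(m,u)[(\alpha,x).v]\mapsto v[m/\alpha][u/x]$. The constants $\mathsf{MP}_P$ and $\mathsf{H}_0^{\bot\rightarrow P}$ have no reduction rules. A term is in normal form if none of its subterms is a redex. *)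

theory Defs
  imports Main
begin

text \<open>
  Syntax is represented up to renaming of bound variables by de Bruijn indices, with two independent
  index spaces: first-order variables (bound by quantifiers, \<open>TLam\<close>, \<open>Unpack\<close> and \<open>MP\<close>) and proof
  variables (bound by \<open>Lam\<close>, \<open>Case\<close> and \<open>Unpack\<close>).

  A language is given by its sets of function and predicate symbols, each paired with its arity;
  either set may be empty.
\<close>

record ('f, 'p) language =
  funs :: "('f \<times> nat) set"
  preds :: "('p \<times> nat) set"


section \<open>First-order terms and formulas\<close>

datatype 'f trm = Var nat | Fn 'f "'f trm list"

datatype ('f, 'p) fm =
    Atom 'p "'f trm list"
  | Bot
  | Conj "('f, 'p) fm" "('f, 'p) fm"
  | Disj "('f, 'p) fm" "('f, 'p) fm"
  | Imp "('f, 'p) fm" "('f, 'p) fm"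
  | Forall "('f, 'p) fm"
  | Exists "('f, 'p) fm"

abbreviation Neg :: "('f, 'p) fm \<Rightarrow> ('f, 'p) fm" where
  "Neg A \<equiv> Imp A Bot"

primrec wf_trm :: "('f, 'p) language \<Rightarrow> 'f trm \<Rightarrow> bool" where
  "wf_trm L (Var n) \<longleftrightarrow> True"
| "wf_trm L (Fn f ts) \<longleftrightarrow> (f, length ts) \<in> funs L \<and> list_all (wf_trm L) ts"

primrec wf_fm :: "('f, 'p) language \<Rightarrow> ('f, 'p) fm \<Rightarrow> bool" where
  "wf_fm L (Atom p ts) \<longleftrightarrow> (p, length ts) \<in> preds L \<and> list_all (wf_trm L) ts"
| "wf_fm L Bot \<longleftrightarrow> True"
| "wf_fm L (Conj A B) \<longleftrightarrow> wf_fm L A \<and> wf_fm L B"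
| "wf_fm L (Disj A B) \<longleftrightarrow> wf_fm L A \<and> wf_fm L B"
| "wf_fm L (Imp A B) \<longleftrightarrow> wf_fm L A \<and> wf_fm L B"
| "wf_fm L (Forall A) \<longleftrightarrow> wf_fm L A"
| "wf_fm L (Exists A) \<longleftrightarrow> wf_fm L A"

primrec propositional :: "('f, 'p) fm \<Rightarrow> bool" where
  "propositional (Atom p ts) \<longleftrightarrow> True"
| "propositional Bot \<longleftrightarrow> True"
| "propositional (Conj A B) \<longleftrightarrow> propositional A \<and> propositional B"
| "propositional (Disj A B) \<longleftrightarrow> propositional A \<and> propositional B"
| "propositional (Imp A B) \<longleftrightarrow> propositional A \<and> propositional B"
| "propositional (Forall A) \<longleftrightarrow> False"
| "propositional (Exists A) \<longleftrightarrow> False"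

primrec imp_free :: "('f, 'p) fm \<Rightarrow> bool" where
  "imp_free (Atom p ts) \<longleftrightarrow> True"
| "imp_free Bot \<longleftrightarrow> True"
| "imp_free (Conj A B) \<longleftrightarrow> imp_free A \<and> imp_free B"
| "imp_free (Disj A B) \<longleftrightarrow> imp_free A \<and> imp_free B"
| "imp_free (Imp A B) \<longleftrightarrow> False"
| "imp_free (Forall A) \<longleftrightarrow> imp_free A"
| "imp_free (Exists A) \<longleftrightarrow> imp_free A"


subsection \<open>Simultaneous substitution of first-order terms\<close>

primrec subst_trm :: "(nat \<Rightarrow> 'f trm) \<Rightarrow> 'f trm \<Rightarrow> 'f trm" where
  "subst_trm \<sigma> (Var n) = \<sigma> n"
| "subst_trm \<sigma> (Fn f ts) = Fn f (map (subst_trm \<sigma>) ts)"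

definition shift :: "nat \<Rightarrow> 'f trm" where
  "shift n = Var (Suc n)"

text \<open>The action of a substitution below a binder of a first-order variable.\<close>

definition under :: "(nat \<Rightarrow> 'f trm) \<Rightarrow> nat \<Rightarrow> 'f trm" where
  "under \<sigma> = case_nat (Var 0) (\<lambda>n. subst_trm shift (\<sigma> n))"

text \<open>\<open>single m\<close> replaces the variable of an opened binder by \<open>m\<close> and lowers all the others.\<close>

definition single :: "'f trm \<Rightarrow> nat \<Rightarrow> 'f trm" where
  "single m = case_nat m Var"

primrec subst_fm :: "(nat \<Rightarrow> 'f trm) \<Rightarrow> ('f, 'p) fm \<Rightarrow> ('f, 'p) fm" where
  "subst_fm \<sigma> (Atom p ts) = Atom p (map (subst_trm \<sigma>) ts)"
| "subst_fm \<sigma> Bot = Bot"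
| "subst_fm \<sigma> (Conj A B) = Conj (subst_fm \<sigma> A) (subst_fm \<sigma> B)"
| "subst_fm \<sigma> (Disj A B) = Disj (subst_fm \<sigma> A) (subst_fm \<sigma> B)"
| "subst_fm \<sigma> (Imp A B) = Imp (subst_fm \<sigma> A) (subst_fm \<sigma> B)"
| "subst_fm \<sigma> (Forall A) = Forall (subst_fm (under \<sigma>) A)"
| "subst_fm \<sigma> (Exists A) = Exists (subst_fm (under \<sigma>) A)"

text \<open>If \<open>A\<close> is the body of \<open>Forall A\<close> or \<open>Exists A\<close>, then \<open>inst A m\<close> is $A[m/\alpha]$.\<close>

abbreviation inst :: "('f, 'p) fm \<Rightarrow> 'f trm \<Rightarrow> ('f, 'p) fm" where
  "inst A m \<equiv> subst_fm (single m) A"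

text \<open>\<open>lift A\<close> is \<open>A\<close> regarded below one more binder, whose variable does not occur in it.\<close>

abbreviation lift :: "('f, 'p) fm \<Rightarrow> ('f, 'p) fm" where
  "lift A \<equiv> subst_fm shift A"


section \<open>Proof terms\<close>

text \<open>
  \<open>TApp\<close> and \<open>TLam\<close> are application to, and abstraction over, first-order objects. The formula
  in \<open>MP P\<close> is the body of $\exists\alpha\,P$, whose variable is index 0 of \<open>P\<close>.
\<close>

datatype ('f, 'p) pterm =
    PVar nat
  | App "('f, 'p) pterm" "('f, 'p) pterm"
  | TApp "('f, 'p) pterm" "'f trm"
  | Lam "('f, 'p) pterm"
  | TLam "('f, 'p) pterm"
  | Pair "('f, 'p) pterm" "('f, 'p) pterm"
  | Proj0 "('f, 'p) pterm"
  | Proj1 "('f, 'p) pterm"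
  | Inj0 "('f, 'p) pterm"
  | Inj1 "('f, 'p) pterm"
  | Case "('f, 'p) pterm" "('f, 'p) pterm" "('f, 'p) pterm"
  | Pack "'f trm" "('f, 'p) pterm"
  | Unpack "('f, 'p) pterm" "('f, 'p) pterm"
  | H "('f, 'p) fm"
  | MP "('f, 'p) fm"

primrec tsubst :: "(nat \<Rightarrow> 'f trm) \<Rightarrow> ('f, 'p) pterm \<Rightarrow> ('f, 'p) pterm" where
  "tsubst \<sigma> (PVar n) = PVar n"
| "tsubst \<sigma> (App t u) = App (tsubst \<sigma> t) (tsubst \<sigma> u)"
| "tsubst \<sigma> (TApp t m) = TApp (tsubst \<sigma> t) (subst_trm \<sigma> m)"
| "tsubst \<sigma> (Lam u) = Lam (tsubst \<sigma> u)"
| "tsubst \<sigma> (TLam u) = TLam (tsubst (under \<sigma>) u)"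
| "tsubst \<sigma> (Pair t u) = Pair (tsubst \<sigma> t) (tsubst \<sigma> u)"
| "tsubst \<sigma> (Proj0 u) = Proj0 (tsubst \<sigma> u)"
| "tsubst \<sigma> (Proj1 u) = Proj1 (tsubst \<sigma> u)"
| "tsubst \<sigma> (Inj0 u) = Inj0 (tsubst \<sigma> u)"
| "tsubst \<sigma> (Inj1 u) = Inj1 (tsubst \<sigma> u)"
| "tsubst \<sigma> (Case t u v) = Case (tsubst \<sigma> t) (tsubst \<sigma> u) (tsubst \<sigma> v)"
| "tsubst \<sigma> (Pack m t) = Pack (subst_trm \<sigma> m) (tsubst \<sigma> t)"
| "tsubst \<sigma> (Unpack t u) = Unpack (tsubst \<sigma> t) (tsubst (under \<sigma>) u)"
| "tsubst \<sigma> (H P) = H (subst_fm \<sigma> P)"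
| "tsubst \<sigma> (MP P) = MP (subst_fm (under \<sigma>) P)"

definition under_ren :: "(nat \<Rightarrow> nat) \<Rightarrow> nat \<Rightarrow> nat" where
  "under_ren \<rho> = case_nat 0 (\<lambda>n. Suc (\<rho> n))"

primrec prename :: "(nat \<Rightarrow> nat) \<Rightarrow> ('f, 'p) pterm \<Rightarrow> ('f, 'p) pterm" where
  "prename \<rho> (PVar n) = PVar (\<rho> n)"
| "prename \<rho> (App t u) = App (prename \<rho> t) (prename \<rho> u)"
| "prename \<rho> (TApp t m) = TApp (prename \<rho> t) m"
| "prename \<rho> (Lam u) = Lam (prename (under_ren \<rho>) u)"
| "prename \<rho> (TLam u) = TLam (prename \<rho> u)"
| "prename \<rho> (Pair t u) = Pair (prename \<rho> t) (prename \<rho> u)"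
| "prename \<rho> (Proj0 u) = Proj0 (prename \<rho> u)"
| "prename \<rho> (Proj1 u) = Proj1 (prename \<rho> u)"
| "prename \<rho> (Inj0 u) = Inj0 (prename \<rho> u)"
| "prename \<rho> (Inj1 u) = Inj1 (prename \<rho> u)"
| "prename \<rho> (Case t u v) =
     Case (prename \<rho> t) (prename (under_ren \<rho>) u) (prename (under_ren \<rho>) v)"
| "prename \<rho> (Pack m t) = Pack m (prename \<rho> t)"
| "prename \<rho> (Unpack t u) = Unpack (prename \<rho> t) (prename (under_ren \<rho>) u)"
| "prename \<rho> (H P) = H P"
| "prename \<rho> (MP P) = MP P"

text \<open>
  The action of a substitution for proof variables below a binder of a proof variable, and below a
  binder of a first-order variable.
\<close>

definition under_p :: "(nat \<Rightarrow> ('f, 'p) pterm) \<Rightarrow> nat \<Rightarrow> ('f, 'p) pterm" where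
  "under_p \<tau> = case_nat (PVar 0) (\<lambda>n. prename Suc (\<tau> n))"

definition under_t :: "(nat \<Rightarrow> ('f, 'p) pterm) \<Rightarrow> nat \<Rightarrow> ('f, 'p) pterm" where
  "under_t \<tau> = (\<lambda>n. tsubst shift (\<tau> n))"

definition psingle :: "('f, 'p) pterm \<Rightarrow> nat \<Rightarrow> ('f, 'p) pterm" where
  "psingle u = case_nat u PVar"

primrec psubst :: "(nat \<Rightarrow> ('f, 'p) pterm) \<Rightarrow> ('f, 'p) pterm \<Rightarrow> ('f, 'p) pterm" where
  "psubst \<tau> (PVar n) = \<tau> n"
| "psubst \<tau> (App t u) = App (psubst \<tau> t) (psubst \<tau> u)"
| "psubst \<tau> (TApp t m) = TApp (psubst \<tau> t) m"
| "psubst \<tau> (Lam u) = Lam (psubst (under_p \<tau>) u)"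
| "psubst \<tau> (TLam u) = TLam (psubst (under_t \<tau>) u)"
| "psubst \<tau> (Pair t u) = Pair (psubst \<tau> t) (psubst \<tau> u)"
| "psubst \<tau> (Proj0 u) = Proj0 (psubst \<tau> u)"
| "psubst \<tau> (Proj1 u) = Proj1 (psubst \<tau> u)"
| "psubst \<tau> (Inj0 u) = Inj0 (psubst \<tau> u)"
| "psubst \<tau> (Inj1 u) = Inj1 (psubst \<tau> u)"
| "psubst \<tau> (Case t u v) = Case (psubst \<tau> t) (psubst (under_p \<tau>) u) (psubst (under_p \<tau>) v)"
| "psubst \<tau> (Pack m t) = Pack m (psubst \<tau> t)"
| "psubst \<tau> (Unpack t u) = Unpack (psubst \<tau> t) (psubst (under_p (under_t \<tau>)) u)"
| "psubst \<tau> (H P) = H P"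
| "psubst \<tau> (MP P) = MP P"


section \<open>The system IL + HMP\<close>

text \<open>
  A context is a list whose \<open>n\<close>-th entry is the formula assigned to proof variable \<open>n\<close>. Lifting the
  context (and, for \<open>exE\<close>, the conclusion) expresses the eigenvariable conditions of \<open>allI\<close> and
  \<open>exE\<close>. Well-formedness over \<open>L\<close> is required where it does not already follow from the premises, so
  only contexts, formulas and terms of \<open>L\<close> occur in derivations.

  As everywhere in this system, \<open>P\<close> ranges over propositional formulas in the axioms for \<open>H\<close>.
\<close>

inductive derivable ::
  "('f, 'p) language \<Rightarrow> ('f, 'p) fm list \<Rightarrow> ('f, 'p) pterm \<Rightarrow> ('f, 'p) fm \<Rightarrow> bool"
  ("_; _ \<turnstile> _ : _" [51, 51, 51, 51] 50)
  for L :: "('f, 'p) language"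
where
  var: "\<lbrakk>list_all (wf_fm L) \<Gamma>; n < length \<Gamma>\<rbrakk> \<Longrightarrow> L; \<Gamma> \<turnstile> PVar n : \<Gamma> ! n"
| mp: "\<lbrakk>list_all (wf_fm L) \<Gamma>; wf_fm L P; propositional P; imp_free P\<rbrakk>
    \<Longrightarrow> L; \<Gamma> \<turnstile> MP P : Imp (Neg (Neg (Exists P))) (Exists P)"
| efq: "\<lbrakk>list_all (wf_fm L) \<Gamma>; wf_fm L P; propositional P\<rbrakk> \<Longrightarrow> L; \<Gamma> \<turnstile> H P : Imp Bot P"
| conjI: "\<lbrakk>L; \<Gamma> \<turnstile> u : A; L; \<Gamma> \<turnstile> t : B\<rbrakk> \<Longrightarrow> L; \<Gamma> \<turnstile> Pair u t : Conj A B"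
| conjE0: "L; \<Gamma> \<turnstile> u : Conj A B \<Longrightarrow> L; \<Gamma> \<turnstile> Proj0 u : A"
| conjE1: "L; \<Gamma> \<turnstile> u : Conj A B \<Longrightarrow> L; \<Gamma> \<turnstile> Proj1 u : B"
| impE: "\<lbrakk>L; \<Gamma> \<turnstile> t : Imp A B; L; \<Gamma> \<turnstile> u : A\<rbrakk> \<Longrightarrow> L; \<Gamma> \<turnstile> App t u : B"
| impI: "L; A # \<Gamma> \<turnstile> u : B \<Longrightarrow> L; \<Gamma> \<turnstile> Lam u : Imp A B"
| disjI0: "\<lbrakk>L; \<Gamma> \<turnstile> u : A; wf_fm L B\<rbrakk> \<Longrightarrow> L; \<Gamma> \<turnstile> Inj0 u : Disj A B"
| disjI1: "\<lbrakk>L; \<Gamma> \<turnstile> u : B; wf_fm L A\<rbrakk> \<Longrightarrow> L; \<Gamma> \<turnstile> Inj1 u : Disj A B"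
| disjE: "\<lbrakk>L; \<Gamma> \<turnstile> u : Disj A B; L; A # \<Gamma> \<turnstile> w1 : C; L; B # \<Gamma> \<turnstile> w2 : C\<rbrakk>
    \<Longrightarrow> L; \<Gamma> \<turnstile> Case u w1 w2 : C"
| allE: "\<lbrakk>L; \<Gamma> \<turnstile> u : Forall A; wf_trm L m\<rbrakk> \<Longrightarrow> L; \<Gamma> \<turnstile> TApp u m : inst A m"
| allI: "L; map lift \<Gamma> \<turnstile> u : A \<Longrightarrow> L; \<Gamma> \<turnstile> TLam u : Forall A"
| exI: "\<lbrakk>L; \<Gamma> \<turnstile> u : inst A m; wf_trm L m\<rbrakk> \<Longrightarrow> L; \<Gamma> \<turnstile> Pack m u : Exists A"
| exE: "\<lbrakk>L; \<Gamma> \<turnstile> u : Exists A; L; A # map lift \<Gamma> \<turnstile> t : lift C\<rbrakk> \<Longrightarrow> L; \<Gamma> \<turnstile> Unpack u t : C"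


section \<open>Reduction and normal forms\<close>

inductive contracts :: "('f, 'p) pterm \<Rightarrow> ('f, 'p) pterm \<Rightarrow> bool" (infix "\<mapsto>" 50) where
  "App (Lam u) t \<mapsto> psubst (psingle t) u"
| "TApp (TLam u) m \<mapsto> tsubst (single m) u"
| "Proj0 (Pair u0 u1) \<mapsto> u0"
| "Proj1 (Pair u0 u1) \<mapsto> u1"
| "Case (Inj0 u) t0 t1 \<mapsto> psubst (psingle u) t0"
| "Case (Inj1 u) t0 t1 \<mapsto> psubst (psingle u) t1"
| "Unpack (Pack m u) v \<mapsto> psubst (psingle u) (tsubst (single m) v)"

definition redex :: "('f, 'p) pterm \<Rightarrow> bool" where
  "redex t \<longleftrightarrow> (\<exists>t'. t \<mapsto> t')"

primrec subterms :: "('f, 'p) pterm \<Rightarrow> ('f, 'p) pterm set" where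
  "subterms (PVar n) = {PVar n}"
| "subterms (App t u) = {App t u} \<union> subterms t \<union> subterms u"
| "subterms (TApp t m) = {TApp t m} \<union> subterms t"
| "subterms (Lam u) = {Lam u} \<union> subterms u"
| "subterms (TLam u) = {TLam u} \<union> subterms u"
| "subterms (Pair t u) = {Pair t u} \<union> subterms t \<union> subterms u"
| "subterms (Proj0 u) = {Proj0 u} \<union> subterms u"
| "subterms (Proj1 u) = {Proj1 u} \<union> subterms u"
| "subterms (Inj0 u) = {Inj0 u} \<union> subterms u"
| "subterms (Inj1 u) = {Inj1 u} \<union> subterms u"
| "subterms (Case t u v) = {Case t u v} \<union> subterms t \<union> subterms u \<union> subterms v"
| "subterms (Pack m t) = {Pack m t} \<union> subterms t"
| "subterms (Unpack t u) = {Unpack t u} \<union> subterms t \<union> subterms u"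
| "subterms (H P) = {H P}"
| "subterms (MP P) = {MP P}"

definition normal :: "('f, 'p) pterm \<Rightarrow> bool" where
  "normal t \<longleftrightarrow> (\<forall>s \<in> subterms t. \<not> redex s)"

end

theory Submission
  imports Defs
begin

text \<open>
  A closed normal term is an introduction or one of the constants: by induction, the main premise
  of a final elimination is of that form too, so that the term is either a redex or an application
  of \<open>H\<close> or \<open>MP\<close> to a closed proof of \<open>Bot\<close> or of \<open>Neg (Neg (Exists P))\<close>. Such closed
  proofs do not exist: in the classical one-point model in which every atom is false, every
  implication-free formula \<open>P\<close> is false, and every theorem is true.
\<close>

text \<open>Truth in the one-point model, where quantifiers are vacuous and no environment is needed.\<close>

primrec truth :: "('f, 'p) fm \<Rightarrow> bool" where
  "truth (Atom p ts) \<longleftrightarrow> False"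
| "truth Bot \<longleftrightarrow> False"
| "truth (Conj A B) \<longleftrightarrow> truth A \<and> truth B"
| "truth (Disj A B) \<longleftrightarrow> truth A \<or> truth B"
| "truth (Imp A B) \<longleftrightarrow> (truth A \<longrightarrow> truth B)"
| "truth (Forall A) \<longleftrightarrow> truth A"
| "truth (Exists A) \<longleftrightarrow> truth A"

lemma truth_subst_fm [simp]: "truth (subst_fm \<sigma> A) \<longleftrightarrow> truth A"
  by (induction A arbitrary: \<sigma>) auto

lemma truth_imp_free: "imp_free A \<Longrightarrow> \<not> truth A"
  by (induction A) auto

text \<open>Soundness: \<open>MP\<close> holds because the model is classical, \<open>H\<close>
  because \<open>Bot\<close> is false, and the quantifier rules because substitution does not affect
  truth.\<close>

lemma derivable_truth: "L; \<Gamma> \<turnstile> t : A \<Longrightarrow> list_all truth \<Gamma> \<Longrightarrow> truth A"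
  by (induction rule: derivable.induct) (auto simp: list_all_iff)

lemma not_derivable_Bot: "\<not> (L; [] \<turnstile> t : Bot)"
  using derivable_truth by fastforce

lemma not_derivable_Neg_Neg_Exists:
  "imp_free P \<Longrightarrow> \<not> (L; [] \<turnstile> t : Neg (Neg (Exists P)))"
  using derivable_truth truth_imp_free by fastforce

lemma redex_simps [simp]:
  "redex (App (Lam u) t)"
  "redex (TApp (TLam u) m)"
  "redex (Proj0 (Pair t u))"
  "redex (Proj1 (Pair t u))"
  "redex (Case (Inj0 t) u v)"
  "redex (Case (Inj1 t) u v)"
  "redex (Unpack (Pack m t) u)"
  unfolding redex_def by (blast intro: contracts.intros)+

lemma subterms_refl [simp]: "t \<in> subterms t"
  by (cases t) auto

lemma not_redex_if_normal: "normal t \<Longrightarrow> \<not> redex t"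
  by (simp add: normal_def)

lemma normal_main_premise:
  "normal (App t u) \<Longrightarrow> normal t"
  "normal (TApp t m) \<Longrightarrow> normal t"
  "normal (Proj0 t) \<Longrightarrow> normal t"
  "normal (Proj1 t) \<Longrightarrow> normal t"
  "normal (Case t u v) \<Longrightarrow> normal t"
  "normal (Unpack t u) \<Longrightarrow> normal t"
  by (auto simp: normal_def)

text \<open>For \<open>H\<close> and \<open>MP\<close>, the \<open>Imp\<close> clause keeps only the
  antecedent, which has no closed proof. The \<open>Disj\<close> and \<open>Exists\<close> clauses
  carry the derivations to be extracted.\<close>

fun canonical :: "('f, 'p) language \<Rightarrow> ('f, 'p) pterm \<Rightarrow> ('f, 'p) fm \<Rightarrow> bool" where
  "canonical L t (Conj A B) \<longleftrightarrow> (\<exists>u v. t = Pair u v)"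
| "canonical L t (Disj A B) \<longleftrightarrow>
     (\<exists>u. t = Inj0 u \<and> (L; [] \<turnstile> u : A)) \<or> (\<exists>u. t = Inj1 u \<and> (L; [] \<turnstile> u : B))"
| "canonical L t (Imp A B) \<longleftrightarrow>
     (\<exists>u. t = Lam u) \<or> A = Bot \<or> (\<exists>P. A = Neg (Neg (Exists P)) \<and> imp_free P)"
| "canonical L t (Forall A) \<longleftrightarrow> (\<exists>u. t = TLam u)"
| "canonical L t (Exists A) \<longleftrightarrow>
     (\<exists>m u. t = Pack m u \<and> wf_trm L m \<and> (L; [] \<turnstile> u : inst A m))"
| "canonical L t A \<longleftrightarrow> False"

text \<open>With \<open>\<Gamma> = []\<close> as a separate hypothesis, the induction hypotheses for
  premises in an extended context hold vacuously.\<close>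

lemma canonical_if_normal:
  "L; \<Gamma> \<turnstile> t : A \<Longrightarrow> \<Gamma> = [] \<Longrightarrow> normal t \<Longrightarrow> canonical L t A"
proof (induction rule: derivable.induct)
  case (impE \<Gamma> t A B u)
  \<comment> \<open>Contradictory case: if \<open>t\<close> is a \<open>Lam\<close>, then
    \<open>App t u\<close> is a redex; otherwise \<open>u\<close> is a closed proof of an unprovable
    antecedent.\<close>
  then show ?case
    using not_redex_if_normal[OF impE.prems(2)] not_derivable_Bot not_derivable_Neg_Neg_Exists
    by (fastforce dest: normal_main_premise)
qed (fastforce dest: normal_main_premise not_redex_if_normal)+

theorem theorem2p4:
  fixes L :: "('f, 'p) language"
  shows "(\<forall>t A. (L; [] \<turnstile> t : Exists A) \<and> normal t \<longrightarrow>
            (\<exists>m u. t = Pack m u \<and> wf_trm L m \<and> (L; [] \<turnstile> u : inst A m)))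
       \<and> (\<forall>t A B. (L; [] \<turnstile> t : Disj A B) \<and> normal t \<longrightarrow>
            (\<exists>u. t = Inj0 u \<and> (L; [] \<turnstile> u : A)) \<or> (\<exists>u. t = Inj1 u \<and> (L; [] \<turnstile> u : B)))"
  using canonical_if_normal by fastforce

end
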